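(* Let $L$ be a nonempty language, let $C$ be a finite consequence operator on $L$, and let $\mathbf{RI}^*$ be the general logic-system (general rules of inference) on $L$ defined from $C$ (for any choice of enumerations of the nonempty finite subsets of $L$), namely $\mathbf{RI}^*=\{R^1\}\cup\{R^{n+1}_F(C)\mid n\ge1,\ n\in\mathbb{N}\}$. If $C^*$ is the finite consequence operator generated by $\mathbf{RI}^*$, then $C^*=C$.
   Context: A language $L$ is just a nonempty set. Write $\mathcal{P}(L)$ for the power set of $L$ and $\mathcal{F}(X)$ for the set of finite subsets of $X$; $\subset$ allows equality. A general consequence operator on $L$ is a map $C\colon\mathcal{P}(L)\to\mathcal{P}(L)$ such that for all $X,Y\in\mathcal{P}(L)$: (i) $X\subset C(X)=C(C(X))\subset L$; (ii) if $X\subset Y$ then $C(X)\subset C(Y)$. It is finite if moreover (iii) $C(X)=\bigcup\{C(A)\mid A\in\mathcal{F}(X)\}$ for all $X$. A general logic-system on $L$ is a nonempty (finite or infinite) set $\mathbf{RI}$ of relations (rules of inference), each of which is an $n$-ary relation, i.e. a subset (possibly empty) of $L^n$, for some integer $n\ge1$ depending on the relation (with $L^1$ identified with $L$). An $\mathbf{RI}$-deduction from $X\subset L$ is a finite sequence $b_1,\dots,b_m$ ($m\ge1$) of members of $L$ such that for each $i$ either $b_i\in X$, or $b_i$ belongs to a unary relation in $\mathbf{RI}$, or there are $k\ge1$, a $(k+1)$-ary relation $R\in\mathbf{RI}$ and $(y_1,\dots,y_{k+1})\in R$ such that $y_{k+1}=b_i$ and each of $y_1,\dots,y_k$ lies in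 $X$, or in a unary relation of $\mathbf{RI}$, or in $\{b_1,\dots,b_{i-1}\}$. The consequence operator generated (defined) by $\mathbf{RI}$ sends $X$ to the set of all $x\in L$ for which there is an $\mathbf{RI}$-deduction from $X$ whose last term is $x$; it is a finite consequence operator. Definition of $\mathbf{RI}^*$ from a general consequence operator $C$ on $L$: put $R^1=C(\emptyset)$ (a unary relation). For each nonempty $X\in\mathcal{F}(L)$ with $|X|=n$, choose an enumeration $X=\{x_1,\dots,x_n\}$ and define an $(n+1)$-ary relation by $R^{n+1}_X(C)=\{(x_1,\dots,x_n,y)\mid y\in C(X)-(X\cup R^1)\}$ if $C(X)\ne X\cup R^1$, and $R^{n+1}_X(C)=\emptyset$ otherwise. For each integer $n\ge1$ let $R^{n+1}_F(C)=\bigcup\{R^{n+1}_X(C)\mid X\in\mathcal{F}(L),\ |X|=n\}$. Then $\mathbf{RI}^*=\{R^1\}\cup\{R^{n+1}_F(C)\mid n\ge1,\ n\in\mathbb{N}\}$; it depends on the chosen enumerations and so is not unique. *)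

theory Defs
  imports Main "HOL-Library.FuncSet"
begin

text \<open>A language is a nonempty set \<open>L :: 'a set\<close>. An operator on the power set of \<open>L\<close> is a
  function \<open>'a set \<Rightarrow> 'a set\<close> of which only the values on \<open>Pow L\<close> are relevant.\<close>

definition consequence_operator :: "'a set \<Rightarrow> ('a set \<Rightarrow> 'a set) \<Rightarrow> bool" where
  "consequence_operator L C \<longleftrightarrow>
     C \<in> Pow L \<rightarrow> Pow L \<and>
     (\<forall>X\<in>Pow L. X \<subseteq> C X \<and> C X = C (C X) \<and> C X \<subseteq> L) \<and>
     (\<forall>X\<in>Pow L. \<forall>Y\<in>Pow L. X \<subseteq> Y \<longrightarrow> C X \<subseteq> C Y)"

definition finite_consequence_operator :: "'a set \<Rightarrow> ('a set \<Rightarrow> 'a set) \<Rightarrow> bool" where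
  "finite_consequence_operator L C \<longleftrightarrow>
     consequence_operator L C \<and>
     (\<forall>X\<in>Pow L. C X = \<Union> {C A | A. A \<subseteq> X \<and> finite A})"

text \<open>Tuples are lists, so \<open>L\<^sup>n\<close> is the set of lists of length \<open>n\<close> over \<open>L\<close>, and an element \<open>x\<close> of a
  unary relation appears as \<open>[x]\<close>. A nonempty relation has exactly one arity; the empty
  relation has every arity, since it is a subset of every \<open>L\<^sup>n\<close>.\<close>

definition nary_relation :: "'a set \<Rightarrow> nat \<Rightarrow> 'a list set \<Rightarrow> bool" where
  "nary_relation L n R \<longleftrightarrow> R \<subseteq> {ys. length ys = n \<and> set ys \<subseteq> L}"

definition logic_system :: "'a set \<Rightarrow> 'a list set set \<Rightarrow> bool" where
  "logic_system L RI \<longleftrightarrow> RI \<noteq> {} \<and> (\<forall>R\<in>RI. \<exists>n\<ge>1. nary_relation L n R)"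

definition in_unary :: "'a set \<Rightarrow> 'a list set set \<Rightarrow> 'a \<Rightarrow> bool" where
  "in_unary L RI x \<longleftrightarrow> (\<exists>R\<in>RI. nary_relation L 1 R \<and> [x] \<in> R)"

text \<open>Positions are counted from \<open>0\<close>: \<open>set (take i bs)\<close> collects the terms preceding \<open>bs ! i\<close>,
  and a tuple \<open>ys\<close> of length \<open>k + 1\<close> has premises \<open>ys ! 0, \<dots>, ys ! (k - 1)\<close> and
  conclusion \<open>ys ! k\<close>.\<close>

definition deduction :: "'a set \<Rightarrow> 'a list set set \<Rightarrow> 'a set \<Rightarrow> 'a list \<Rightarrow> bool" where
  "deduction L RI X bs \<longleftrightarrow>
     length bs \<ge> 1 \<and> set bs \<subseteq> L \<and>
     (\<forall>i<length bs.
        bs ! i \<in> X \<or>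
        in_unary L RI (bs ! i) \<or>
        (\<exists>k\<ge>1. \<exists>R\<in>RI. nary_relation L (k + 1) R \<and>
           (\<exists>ys\<in>R. ys ! k = bs ! i \<and>
              (\<forall>j<k. ys ! j \<in> X \<or> in_unary L RI (ys ! j) \<or> ys ! j \<in> set (take i bs)))))"

definition generated_operator :: "'a set \<Rightarrow> 'a list set set \<Rightarrow> 'a set \<Rightarrow> 'a set" where
  "generated_operator L RI X = {x \<in> L. \<exists>bs. deduction L RI X bs \<and> last bs = x}"

text \<open>A choice, for every nonempty finite \<open>X \<subseteq> L\<close>, of an enumeration of \<open>X\<close> without repetitions.\<close>

definition enumeration_choice :: "'a set \<Rightarrow> ('a set \<Rightarrow> 'a list) \<Rightarrow> bool" where
  "enumeration_choice L enum \<longleftrightarrow>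
     (\<forall>X. X \<subseteq> L \<and> finite X \<and> X \<noteq> {} \<longrightarrow> set (enum X) = X \<and> distinct (enum X))"

definition R1 :: "('a set \<Rightarrow> 'a set) \<Rightarrow> 'a list set" where
  "R1 C = {[x] | x. x \<in> C {}}"

definition RX :: "('a set \<Rightarrow> 'a set) \<Rightarrow> ('a set \<Rightarrow> 'a list) \<Rightarrow> 'a set \<Rightarrow> 'a list set" where
  "RX C enum X =
     (if C X \<noteq> X \<union> C {} then {enum X @ [y] | y. y \<in> C X - (X \<union> C {})} else {})"

text \<open>\<open>RF L C enum n\<close> is the relation of arity \<open>n + 1\<close> arising from the subsets with \<open>n\<close> elements.\<close>

definition RF ::
  "'a set \<Rightarrow> ('a set \<Rightarrow> 'a set) \<Rightarrow> ('a set \<Rightarrow> 'a list) \<Rightarrow> nat \<Rightarrow> 'a list set" where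
  "RF L C enum n = \<Union> {RX C enum X | X. X \<subseteq> L \<and> finite X \<and> card X = n}"

definition RI_star ::
  "'a set \<Rightarrow> ('a set \<Rightarrow> 'a set) \<Rightarrow> ('a set \<Rightarrow> 'a list) \<Rightarrow> 'a list set set" where
  "RI_star L C enum = {R1 C} \<union> {RF L C enum n | n. n \<ge> 1}"

lemma logic_system_RI_star:
  assumes C: "consequence_operator L C" and enum: "enumeration_choice L enum"
  shows "logic_system L (RI_star L C enum)"
proof -
  have sub: "C X \<subseteq> L" if "X \<subseteq> L" for X
    using C that by (auto simp: consequence_operator_def)
  have "nary_relation L 1 (R1 C)"
    using sub[of "{}"] by (auto simp: nary_relation_def R1_def)
  moreover have "nary_relation L (n + 1) (RF L C enum n)" if n: "n \<ge> 1" for n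
  proof -
    have "length ys = n + 1 \<and> set ys \<subseteq> L" if "ys \<in> RF L C enum n" for ys
    proof -
      from that obtain X y where X: "X \<subseteq> L" "finite X" "card X = n"
        and ys: "ys = enum X @ [y]" and y: "y \<in> C X"
        by (auto simp: RF_def RX_def split: if_splits)
      from X n have "X \<noteq> {}" by auto
      with enum X have "set (enum X) = X" "distinct (enum X)"
        by (auto simp: enumeration_choice_def)
      then show ?thesis
        using X ys y sub[of X] distinct_card[of "enum X"] by auto
    qed
    then show ?thesis by (auto simp: nary_relation_def)
  qed
  moreover have "1 \<le> n + 1" for n :: nat by simp
  ultimately show ?thesis
    unfolding logic_system_def RI_star_def by blast
qed

end

theory Submission
  imports Defs
begin

text \<open>No rule of \<open>RI_star\<close> leads out of a closed set, because a tuple over \<open>A\<close> has its conclusion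
  in \<open>C A\<close>. Conversely, if \<open>y \<in> C X\<close>, then \<open>y \<in> C A\<close> for a finite \<open>A \<subseteq> X\<close> by finiteness, and the
  one-term sequence \<open>[y]\<close> is already a deduction from \<open>X\<close>: the definition of deductions allows
  the premises of a rule to be taken from \<open>X\<close> without being listed.\<close>

text \<open>\<open>enum\<close> is constrained only on nonempty sets. The bound
  \<open>n \<ge> 1\<close> rules out \<open>A = {}\<close>, and distinctness turns the cardinality
  \<open>n\<close> into the length of the tuple's premise part.\<close>

lemma RF_E:
  assumes "enumeration_choice L enum" "n \<ge> 1" "ys \<in> RF L C enum n"
  obtains A y where "A \<subseteq> L" "set (enum A) = A" "length (enum A) = n"
    "ys = enum A @ [y]" "y \<in> C A"
proof -
  from assms(3) obtain A y where A: "A \<subseteq> L" "finite A" "card A = n"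
    and ys: "ys = enum A @ [y]" "y \<in> C A"
    by (auto simp: RF_def RX_def split: if_splits)
  from A assms(2) have "A \<noteq> {}" by auto
  with A assms(1) have "set (enum A) = A" "distinct (enum A)"
    by (auto simp: enumeration_choice_def)
  with A ys that show thesis
    using distinct_card[of "enum A"] by auto
qed

lemma RI_star_E:
  assumes "R \<in> RI_star L C enum"
  obtains "R = R1 C" | n where "n \<ge> 1" "R = RF L C enum n"
  using assms by (auto simp: RI_star_def)

text \<open>Tuples in \<open>RF L C enum n\<close> have length \<open>n + 1 \<ge> 2\<close>, so
  \<open>[x]\<close> can only come from \<open>R1 C\<close>. An empty \<open>RF\<close> also counts
  as unary, but contributes no element.\<close>

lemma in_unary_RI_star_iff:
  assumes C: "consequence_operator L C" and enum: "enumeration_choice L enum"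
  shows "in_unary L (RI_star L C enum) x \<longleftrightarrow> x \<in> C {}"
proof
  assume "in_unary L (RI_star L C enum) x"
  then obtain R where R: "R \<in> RI_star L C enum" and x: "[x] \<in> R"
    by (auto simp: in_unary_def)
  from R show "x \<in> C {}"
  proof (cases rule: RI_star_E)
    case 1
    with x show ?thesis by (auto simp: R1_def)
  next
    case (2 n)
    with x enum show ?thesis by (auto elim: RF_E)
  qed
next
  assume "x \<in> C {}"
  moreover have "C {} \<subseteq> L"
    using C by (auto simp: consequence_operator_def)
  ultimately have "nary_relation L 1 (R1 C)" "[x] \<in> R1 C"
    by (auto simp: nary_relation_def R1_def)
  then show "in_unary L (RI_star L C enum) x"
    by (auto simp: in_unary_def RI_star_def)
qed

text \<open>Strong induction on positions: if the premises of a rule form a set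
  \<open>A \<subseteq> C X\<close>, monotonicity and idempotence give
  \<open>C A \<subseteq> C (C X) = C X\<close>.\<close>

lemma generated_operator_RI_star_subset:
  assumes C: "consequence_operator L C" and enum: "enumeration_choice L enum"
    and X: "X \<subseteq> L"
  shows "generated_operator L (RI_star L C enum) X \<subseteq> C X"
proof
  have mono: "C A \<subseteq> C B" if "A \<subseteq> B" "B \<subseteq> L" for A B
    using C that by (auto simp: consequence_operator_def)
  have CX: "X \<subseteq> C X" "C (C X) = C X" "C X \<subseteq> L"
    using C X by (auto simp: consequence_operator_def)
  have unary: "x \<in> C X" if "in_unary L (RI_star L C enum) x" for x
    using that mono[of "{}" X] X in_unary_RI_star_iff[OF C enum] by auto
  fix x assume "x \<in> generated_operator L (RI_star L C enum) X"
  then obtain bs where bs: "deduction L (RI_star L C enum) X bs" and x: "last bs = x"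
    by (auto simp: generated_operator_def)
  have "bs ! i \<in> C X" if "i < length bs" for i
    using that
  proof (induction i rule: less_induct)
    case (less i)
    have prev: "z \<in> C X" if "z \<in> set (take i bs)" for z
      using that less by (auto simp: in_set_conv_nth)
    from bs less.prems consider
        "bs ! i \<in> X" | "in_unary L (RI_star L C enum) (bs ! i)"
      | k R ys where "k \<ge> 1" "R \<in> RI_star L C enum" "nary_relation L (k + 1) R" "ys \<in> R"
          "ys ! k = bs ! i"
          "\<forall>j<k. ys ! j \<in> X \<or> in_unary L (RI_star L C enum) (ys ! j) \<or> ys ! j \<in> set (take i bs)"
      unfolding deduction_def by meson
    then show ?case
    proof cases
      case 1
      with CX show ?thesis by auto
    next
      case 2
      then show ?thesis by (rule unary)
    next
      case (3 k R ys)
      have prems: "ys ! j \<in> C X" if "j < k" for j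
        using 3(6) that CX(1) unary prev by blast
      have len: "length ys = k + 1"
        using 3 by (auto simp: nary_relation_def)
      from 3(2) show ?thesis
      proof (cases rule: RI_star_E)
        case 1
        \<comment> \<open>Contradictory case: tuples in \<open>R1 C\<close> have length 1, whereas
          \<open>k \<ge> 1\<close> forces length at least 2.\<close>
        with 3 len show ?thesis by (auto simp: R1_def)
      next
        case (2 n)
        with enum 3(4) obtain A y where A: "set (enum A) = A" "length (enum A) = n"
          and ys: "ys = enum A @ [y]" and y: "y \<in> C A"
          by (auto elim: RF_E)
        \<comment> \<open>The arity fixes \<open>k\<close>, so the premises of the tuple are exactly
          the elements of \<open>A\<close> and its conclusion is \<open>y\<close>.\<close>
        have k: "k = length (enum A)" using len ys by simp
        have "A \<subseteq> C X"
        proof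
          fix a assume "a \<in> A"
          with A obtain j where "j < k" "a = enum A ! j"
            using k by (metis in_set_conv_nth)
          with prems[of j] ys k show "a \<in> C X" by (simp add: nth_append)
        qed
        then have "y \<in> C X" using mono[of A "C X"] CX y by auto
        with ys k 3(5) show ?thesis by simp
      qed
    qed
  qed
  moreover have "bs \<noteq> []" using bs by (auto simp: deduction_def)
  ultimately show "x \<in> C X" using x by (auto simp: last_conv_nth)
qed

lemma subset_generated_operator_RI_star:
  assumes C: "finite_consequence_operator L C" and enum: "enumeration_choice L enum"
    and X: "X \<subseteq> L"
  shows "C X \<subseteq> generated_operator L (RI_star L C enum) X"
proof
  fix y assume y: "y \<in> C X"
  have cons: "consequence_operator L C"
    using C by (simp add: finite_consequence_operator_def)
  have "C X \<subseteq> L"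
    using cons X by (auto simp: consequence_operator_def)
  with y have yL: "y \<in> L" by auto
  have "C X = \<Union> {C A | A. A \<subseteq> X \<and> finite A}"
    using C X by (simp add: finite_consequence_operator_def)
  with y obtain A where A: "A \<subseteq> X" "finite A" "y \<in> C A" by auto
  have "deduction L (RI_star L C enum) X [y]"
  \<comment> \<open>\<open>RX\<close> discards conclusions in \<open>A \<union> C {}\<close>; such
    \<open>y\<close> need no rule with premises.\<close>
  proof (cases "y \<in> X \<or> y \<in> C {}")
    case True
    with yL show ?thesis
      by (auto simp: deduction_def in_unary_RI_star_iff[OF cons enum])
  next
    case False
    with A have ne: "A \<noteq> {}" by auto
    with A X enum have e: "set (enum A) = A" "distinct (enum A)"
      by (auto simp: enumeration_choice_def)
    define n where "n = card A"
    have n: "n \<ge> 1" "length (enum A) = n"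
      using A ne e distinct_card[of "enum A"] by (auto simp: n_def Suc_le_eq card_gt_0_iff)
    \<comment> \<open>Since \<open>A \<subseteq> X\<close>, \<open>y\<close> lies outside
      \<open>A \<union> C {}\<close>; it is thus also the witness that \<open>C A\<close> differs
      from \<open>A \<union> C {}\<close>.\<close>
    have "enum A @ [y] \<in> RX C enum A"
      using A False by (auto simp: RX_def)
    then have mem: "enum A @ [y] \<in> RF L C enum n"
      using A X unfolding RF_def n_def by blast
    have star: "RF L C enum n \<in> RI_star L C enum"
      using n by (auto simp: RI_star_def)
    have nary: "nary_relation L (n + 1) (RF L C enum n)"
      unfolding nary_relation_def
    proof
      fix ys assume "ys \<in> RF L C enum n"
      with enum n(1) obtain B z where "B \<subseteq> L" "set (enum B) = B" "length (enum B) = n"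
        "ys = enum B @ [z]" "z \<in> C B"
        by (rule RF_E)
      moreover from this have "C B \<subseteq> L"
        using cons by (simp add: consequence_operator_def)
      ultimately show "ys \<in> {ys. length ys = n + 1 \<and> set ys \<subseteq> L}" by auto
    qed
    have concl: "(enum A @ [y]) ! n = y" using n by (simp add: nth_append)
    have prems: "\<forall>j<n. (enum A @ [y]) ! j \<in> X"
      using n e A by (auto simp: nth_append)
    \<comment> \<open>\<open>Q\<close> stands for the other admissible sources of a premise. It may
      be arbitrary because every premise already lies in \<open>X\<close>.\<close>
    have "\<exists>ys\<in>RF L C enum n. ys ! n = y \<and> (\<forall>j<n. ys ! j \<in> X \<or> Q (ys ! j))" for Q
      using mem concl prems by blast
    with n(1) star nary
    have "\<exists>k\<ge>1. \<exists>R\<in>RI_star L C enum. nary_relation L (k + 1) R \<and>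
        (\<exists>ys\<in>R. ys ! k = y \<and> (\<forall>j<k. ys ! j \<in> X \<or> Q (ys ! j)))" for Q
      by blast
    with yL show ?thesis
      by (simp add: deduction_def)
  qed
  with yL show "y \<in> generated_operator L (RI_star L C enum) X"
    by (auto simp: generated_operator_def intro!: exI[of _ "[y]"])
qed

theorem theorem2p3:
  fixes L :: "'a set"
    and C :: "'a set \<Rightarrow> 'a set"
    and enum :: "'a set \<Rightarrow> 'a list"
  assumes "L \<noteq> {}"
    and "finite_consequence_operator L C"
    and "enumeration_choice L enum"
  shows "\<forall>X\<in>Pow L. generated_operator L (RI_star L C enum) X = C X"
proof
  fix X assume "X \<in> Pow L"
  then have X: "X \<subseteq> L" by simp
  have "consequence_operator L C"
    using assms(2) by (simp add: finite_consequence_operator_def)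
  then show "generated_operator L (RI_star L C enum) X = C X"
    using generated_operator_RI_star_subset subset_generated_operator_RI_star assms(2,3) X
    by (intro equalityI)
qed

end
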